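(* Let $p,q,r$ be distinct odd primes and let $k$ be an integer with $0\le k\le pqr-1$. Then for each of the following triples $(j_1j_2j_3)$, if $(a_k,b_k,c_k)\in\mathcal{A}^p_{j_1}\times\mathcal{A}^q_{j_2}\times\mathcal{A}^r_{j_3}$, then $\mathrm{oct}(k)\sim$ the listed 8-tuple and $V(k)$ equals the listed value: (001): $(0,1,1,1,1,2,2,2)$, $V(k)=1$; (002): $(0,\delta_{pq},\delta_{qp},1,1+\delta_{qp},1+\delta_{pq},1,2)$, $V(k)=0$; (003): $(0,0,0,1,1,1,1,2)$, $V(k)=-1$; (004): $(0,0,0,1,1,1,0,1)$, $V(k)=0$; (011): $(0,1,1,1,2,1,1,1)$, $V(k)=1$; (012): $(0,\delta_{pq},\delta_{qp},1,1+\delta_{qp},\delta_{pq},1,1)$, $V(k)=\delta_{qp}$; (013): $(0,0,0,1,1,0,1,1)$, $V(k)=0$; (014): $(0,0,0,1,1,0,0,0)$, $V(k)=0$; (022): $(0,\delta_{pq}+\delta_{pr}-1,\delta_{qp},\delta_{rp},\delta_{qp}+\delta_{rp},\delta_{pq},\delta_{pr},1)$, $V(k)=0$; (023): $(1,\delta_{pr},1,1+\delta_{pr},1+\delta_{pr},1,1+\delta_{pr},2)$, $V(k)=-\delta_{rp}$; (024): $(1,\delta_{pr},1,1+\delta_{pr},1+\delta_{pr},1,\delta_{pr},1)$, $V(k)=0$; (033): $(1,0,1,1,1,1,1,2)$, $V(k)=-1$; (034): $(1,0,1,1,1,1,0,1)$, $V(k)=0$; (044): $(1,0,1,1,1,0,0,0)$,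 $V(k)=0$; (111): $(0,1,1,1,1,1,1,0)$, $V(k)=0$; (112): $(0,\delta_{pq},\delta_{qp},1,\delta_{qp},\delta_{pq},1,0)$, $V(k)=0$; (113): $(0,0,0,1,0,0,1,0)$, $V(k)=0$; (114): $(1,1,1,2,1,1,1,0)$, $V(k)=-1$; (122): $(1,\delta_{pq}+\delta_{pr},1+\delta_{qp},1+\delta_{rp},\delta_{qp}+\delta_{rp},1+\delta_{pq},1+\delta_{pr},1)$, $V(k)=\delta_{pq}\delta_{pr}-\delta_{qp}\delta_{rp}$; (123): $(1,\delta_{pr},1,1+\delta_{rp},\delta_{rp},1,1+\delta_{pr},1)$, $V(k)=\delta_{pr}-\delta_{rp}$; (124): $(1,\delta_{pr},1,1+\delta_{rp},\delta_{rp},1,\delta_{pr},0)$, $V(k)=-\delta_{rp}$; (133): $(1,0,1,1,0,1,1,1)$, $V(k)=0$; (134): $(1,0,1,1,0,1,0,0)$, $V(k)=0$; (144): $(2,1,2,2,1,1,1,0)$, $V(k)=-1$; (222): $(1,\delta_{pq}+\delta_{pr},\delta_{qr}+\delta_{qp},\delta_{rp}+\delta_{rq},\delta_{qp}+\delta_{rp},\delta_{rq}+\delta_{pq},\delta_{pr}+\delta_{qr},1)$, $V(k)=0$; (223): $(1,\delta_{pr},\delta_{qr},\delta_{rp}+\delta_{rq},\delta_{rp},\delta_{rq},\delta_{pr}+\delta_{qr},1)$, $V(k)=\delta_{pr}\delta_{qr}-\delta_{rp}\delta_{rq}$; (224): $(1,\delta_{pr},\delta_{qr},\delta_{rp}+\delta_{rq},\delta_{rp},\delta_{rq},\delta_{pr}+\delta_{qr}-1,0)$,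 $V(k)=0$; (233): $(1,0,\delta_{qr},\delta_{rq},0,\delta_{rq},\delta_{qr},1)$, $V(k)=0$; (234): $(2,1,1+\delta_{qr},1+\delta_{rq},1,1+\delta_{rq},\delta_{qr},1)$, $V(k)=\delta_{rq}$; (244): $(2,1,1+\delta_{qr},1+\delta_{rq},1,\delta_{rq},\delta_{qr},0)$, $V(k)=0$; (333): $(1,0,0,0,0,0,0,1)$, $V(k)=0$; (334): $(2,1,1,1,1,1,0,1)$, $V(k)=1$; (344): $(2,1,1,1,1,0,0,0)$, $V(k)=1$.
   Context: Let $p,q,r$ be distinct odd primes. For coprime integers $a,b$ with $b>1$, $a^{-1}(b)$ denotes the inverse of $a$ modulo $b$, taken in $\{1,\dots,b-1\}$. The ternary cyclotomic polynomial is $\Phi_{pqr}(x)=\sum_k a_{pqr}(k)x^k$ (with $a_{pqr}(k)=0$ for $k<0$), and $V(k)=a_{pqr}(k)-a_{pqr}(k-1)$. For every integer $k$ let $F_k\in\mathbb{Z}$, $a_k\in\{0,\dots,p-1\}$, $b_k\in\{0,\dots,q-1\}$, $c_k\in\{0,\dots,r-1\}$ be the unique solution of $k+F_kpqr=a_kqr+b_krp+c_kpq$. Define $\mathrm{oct}(k)=(F_k,F_{k-p},F_{k-q},F_{k-r},F_{k-q-r},F_{k-r-p},F_{k-p-q},F_{k-p-q-r})$, and write $\mathrm{oct}(k)\sim(t_1,\dots,t_8)$ if $\mathrm{oct}(k)=(t_1+u,\dots,t_8+u)$ for some integer $u$. For $x\in\{p,q,r\}$ with $y,z$ the other two primes,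 put $I=\{0,1,\dots,x-1\}$, $s=y^{-1}(x)$, $t=z^{-1}(x)$ and define $\mathcal{A}^x_0=I\cap[0,s+t-x)$, $\mathcal{A}^x_1=I\cap[s+t-x,\min\{s,t\})$, $\mathcal{A}^x_2=I\cap[\min\{s,t\},\max\{s,t\})$, $\mathcal{A}^x_3=I\cap[\max\{s,t\},s+t)$, $\mathcal{A}^x_4=I\cap[s+t,x)$. For an ordered pair of distinct $x,y\in\{p,q,r\}$ with $z$ the third prime, $\delta_{xy}=1$ if $x^{-1}(z)<y^{-1}(z)$ and $\delta_{xy}=0$ otherwise (e.g. $\delta_{qr}=1$ iff $q^{-1}(p)<r^{-1}(p)$, $\delta_{pq}=1$ iff $p^{-1}(r)<q^{-1}(r)$, $\delta_{pr}=1$ iff $p^{-1}(q)<r^{-1}(q)$).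
   Formalization: Three listed 8-tuples are false as printed and are corrected: (001) becomes (0,1,1,1,2,2,1,2), and in (023) and (024) the fourth and fifth entries become 1+δ_rp instead of 1+δ_pr; all V(k) values are unchanged. *)

theory Defs
  imports
    Complex_Main
    "HOL-Computational_Algebra.Polynomial"
    "HOL-Number_Theory.Modular_Inverse"
begin

text \<open>
  The primes and all indices are integers, so that the subtractions are genuine.
  The inverse \<open>a\<^sup>-\<^sup>1(b)\<close> is \<open>modular_inverse b a\<close> (modulus first).
\<close>

definition cyclotomic :: "nat \<Rightarrow> complex poly" where
  "cyclotomic n = (\<Prod>j | j \<in> {1..n} \<and> coprime j n. [:- cis (2 * pi * real j / real n), 1:])"

text \<open>
  Working with the product over the primitive roots of unity, the (integer) coefficients are obtained
  as complex numbers; the index \<open>k\<close> is an integer, with coefficient \<open>0\<close> for \<open>k < 0\<close>.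
\<close>

definition cyclo_coeff :: "int \<Rightarrow> int \<Rightarrow> int \<Rightarrow> int \<Rightarrow> complex" where
  "cyclo_coeff p q r k = (if k < 0 then 0 else coeff (cyclotomic (nat (p * q * r))) (nat k))"

definition V :: "int \<Rightarrow> int \<Rightarrow> int \<Rightarrow> int \<Rightarrow> complex" where
  "V p q r k = cyclo_coeff p q r k - cyclo_coeff p q r (k - 1)"

definition represents :: "int \<Rightarrow> int \<Rightarrow> int \<Rightarrow> int \<Rightarrow> int \<times> int \<times> int \<times> int \<Rightarrow> bool" where
  "represents p q r k = (\<lambda>(F, a, b, c).
     a \<in> {0..<p} \<and> b \<in> {0..<q} \<and> c \<in> {0..<r} \<and>
     k + F * p * q * r = a * q * r + b * r * p + c * p * q)"

lemma represents_ex1: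
  fixes p q r k :: int
  assumes pos: "p > 0" "q > 0" "r > 0"
    and cop: "coprime p q" "coprime p r" "coprime q r"
  shows "\<exists>!s. represents p q r k s"
proof (rule ex_ex1I)
  define a where "a = (k * modular_inverse p (q * r)) mod p"
  define b where "b = (k * modular_inverse q (r * p)) mod q"
  define c where "c = (k * modular_inverse r (p * q)) mod r"
  define S where "S = a * q * r + b * r * p + c * p * q"
  have inv: "[k * modular_inverse x y mod x * y = k] (mod x)" if "coprime x y" for x y :: int
  proof -
    have "[k * modular_inverse x y mod x * y = k * (modular_inverse x y * y)] (mod x)"
      by (simp add: Cong.cong_def mod_mult_left_eq mult.assoc)
    also have "[k * (modular_inverse x y * y) = k * 1] (mod x)"
      using that by (intro cong_mult cong_refl cong_modular_inverse2) (simp add: coprime_commute)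
    finally show ?thesis by simp
  qed
  have "[a * (q * r) = k] (mod p)" "[b * (r * p) = k] (mod q)" "[c * (p * q) = k] (mod r)"
    unfolding a_def b_def c_def using cop by (intro inv; simp add: coprime_commute)+
  then have "p dvd a * (q * r) - k" "q dvd b * (r * p) - k" "r dvd c * (p * q) - k"
    by (simp_all add: cong_iff_dvd_diff)
  moreover have "S - k = (a * (q * r) - k) + p * (b * r + c * q)"
    "S - k = (b * (r * p) - k) + q * (a * r + c * p)"
    "S - k = (c * (p * q) - k) + r * (a * q + b * p)"
    by (simp_all add: S_def algebra_simps)
  ultimately have "p dvd S - k" "q dvd S - k" "r dvd S - k"
    by (metis dvd_add dvd_triv_left)+
  then have "p * q * r dvd S - k"
    using cop by (intro divides_mult) auto
  then obtain F where "S - k = p * q * r * F" by (elim dvdE)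
  then have "represents p q r k (F, a, b, c)"
    using pos by (auto simp: represents_def S_def a_def b_def c_def algebra_simps)
  then show "\<exists>s. represents p q r k s" ..
next
  have digit: "x = x'"
    if "x \<in> {0..<m}" "x' \<in> {0..<m}" "(x - x') * n = m * w" "coprime m n" for m n w x x' :: int
  proof -
    have "m dvd (x - x') * n" using that(3) by simp
    then have "m dvd x - x'" using that(4) by (simp add: coprime_dvd_mult_left_iff)
    then have "x mod m = x' mod m" by (simp add: mod_eq_dvd_iff)
    then show ?thesis using that by simp
  qed
  fix s s' assume *: "represents p q r k s" "represents p q r k s'"
  obtain F a b c where s: "s = (F, a, b, c)" by (cases s)
  obtain F' a' b' c' where s': "s' = (F', a', b', c')" by (cases s')
  have rng: "a \<in> {0..<p}" "a' \<in> {0..<p}" "b \<in> {0..<q}" "b' \<in> {0..<q}"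
      "c \<in> {0..<r}" "c' \<in> {0..<r}"
    and eq: "k + F * p * q * r = a * q * r + b * r * p + c * p * q"
      "k + F' * p * q * r = a' * q * r + b' * r * p + c' * p * q"
    using * by (auto simp: represents_def s s')
  have "(a - a') * (q * r) = p * ((F - F') * q * r - (b - b') * r - (c - c') * q)"
    "(b - b') * (r * p) = q * ((F - F') * p * r - (a - a') * r - (c - c') * p)"
    "(c - c') * (p * q) = r * ((F - F') * p * q - (a - a') * q - (b - b') * p)"
    using eq by (algebra+)
  then have abc: "a = a'" "b = b'" "c = c'"
    using digit rng cop by (metis coprime_commute coprime_mult_right_iff)+
  then have "k + F * p * q * r = k + F' * p * q * r"
    using eq by (simp only:)
  then show "s = s'" using pos abc by (simp add: s s')
qed

definition representation :: "int \<Rightarrow> int \<Rightarrow> int \<Rightarrow> int \<Rightarrow> int \<times> int \<times> int \<times> int" where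
  "representation p q r k = (THE s. represents p q r k s)"

definition F :: "int \<Rightarrow> int \<Rightarrow> int \<Rightarrow> int \<Rightarrow> int" where
  "F p q r k = fst (representation p q r k)"

definition abc :: "int \<Rightarrow> int \<Rightarrow> int \<Rightarrow> int \<Rightarrow> int \<times> int \<times> int" where
  "abc p q r k = snd (representation p q r k)"

definition oct :: "int \<Rightarrow> int \<Rightarrow> int \<Rightarrow> int \<Rightarrow> int list" where
  "oct p q r k =
     [F p q r k, F p q r (k - p), F p q r (k - q), F p q r (k - r),
      F p q r (k - q - r), F p q r (k - r - p), F p q r (k - p - q), F p q r (k - p - q - r)]"

definition oct_sim :: "int list \<Rightarrow> int list \<Rightarrow> bool" (infix "\<sim>" 50) where
  "xs \<sim> ts \<longleftrightarrow> (\<exists>u. xs = map (\<lambda>t. t + u) ts)"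

text \<open>\<open>\<A> x y z j\<close> is the set $\mathcal{A}^x_j$, where \<open>y\<close> and \<open>z\<close> are the other two primes.\<close>

definition \<A> :: "int \<Rightarrow> int \<Rightarrow> int \<Rightarrow> nat \<Rightarrow> int set" where
  "\<A> x y z j = {0..<x} \<inter>
     (let s = modular_inverse x y; t = modular_inverse x z in
      [{0..<s + t - x}, {s + t - x..<min s t}, {min s t..<max s t}, {max s t..<s + t}, {s + t..<x}] ! j)"

definition cell :: "int \<Rightarrow> int \<Rightarrow> int \<Rightarrow> nat \<Rightarrow> nat \<Rightarrow> nat \<Rightarrow> (int \<times> int \<times> int) set" where
  "cell p q r j1 j2 j3 = \<A> p q r j1 \<times> \<A> q r p j2 \<times> \<A> r p q j3"

text \<open>\<open>\<delta> x y z\<close> is $\delta_{xy}$, where \<open>z\<close> is the third prime.\<close>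

definition \<delta> :: "int \<Rightarrow> int \<Rightarrow> int \<Rightarrow> int" where
  "\<delta> x y z = (if modular_inverse z x < modular_inverse z y then 1 else 0)"

end

theory Submission
  imports Defs "HOL-Computational_Algebra.Polynomial_FPS"
begin

text \<open>
  By inclusion-exclusion over the roots of unity,
  \<open>(1 - x) \<Phi>\<^bsub>pqr\<^esub>(x) = (1 - x\<^sup>p) (1 - x\<^sup>q) (1 - x\<^sup>r) H(x)\<close> with
  \<open>H(x) = (1 - x\<^bsup>pqr\<^esup>) / ((1 - x\<^bsup>qr\<^esup>) (1 - x\<^bsup>rp\<^esup>) (1 - x\<^bsup>pq\<^esup>))\<close>. The coefficient of \<open>x\<^sup>k\<close>
  in \<open>H\<close> is \<open>max {0, 1 - F\<^sub>k}\<close>, so \<open>V(k)\<close> is a signed count of the zeros in the octant of \<open>k\<close>, whose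
  entries are all nonnegative.

  Since \<open>p + pqr = r\<^sup>-\<^sup>1(q) rp + q\<^sup>-\<^sup>1(r) pq\<close>, passing from \<open>k\<close> to \<open>k - p\<close> subtracts inverses from
  the digits \<open>b\<^sub>k\<close>, \<open>c\<^sub>k\<close>, and \<open>F\<close> changes by the number of borrows minus one. The borrows depend only
  on the cell containing \<open>(a\<^sub>k, b\<^sub>k, c\<^sub>k)\<close>, which gives the octant up to a shift. Where the shift matters for
  \<open>V(k)\<close>, it is bounded by estimating \<open>a\<^sub>k qr + b\<^sub>k rp + c\<^sub>k pq\<close> on the cell.
\<close>

section \<open>Roots of unity and the cyclotomic polynomial\<close>

text \<open>Both sides have degree at most \<open>m\<close>, agree in the coefficient of degree
  \<open>m\<close> and vanish at the \<open>m\<close> roots of unity, so \<open>m\<close> points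
  suffice.\<close>

lemma prod_roots_of_unity:
  assumes "m > 0"
  shows "(\<Prod>j\<in>{1..m}. [:- cis (2 * pi * real j / real m), 1:]) = monom 1 m - 1"
proof -
  let ?z = "\<lambda>j. cis (2 * pi * real j / real m)"
  let ?P = "\<Prod>j\<in>{1..m}. [:- ?z j, 1:]"
  have bij: "bij_betw ?z {..<m} {z. z ^ m = 1}"
    using assms by (rule bij_betw_roots_unity)
  \<comment> \<open>The end indices \<open>m\<close> and \<open>0\<close> give the same root
    1.\<close>
  have "?z ` {1..m} = ?z ` {..<m}"
  proof -
    have "{1..m} = insert m {1..<m}" "{..<m} = insert 0 {1..<m}" using assms by auto
    moreover have "?z m = ?z 0" using assms by simp
    ultimately show ?thesis by simp
  qed
  then have img: "?z ` {1..m} = {z. z ^ m = 1}"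
    using bij by (simp add: bij_betw_def)
  have card: "card {z::complex. z ^ m = 1} = m"
    using assms by (rule card_roots_unity_eq)
  have deg: "degree ?P = m"
    by (subst degree_prod_sum_eq) auto
  have lead: "lead_coeff ?P = 1"
    by (simp add: lead_coeff_prod)
  show ?thesis
  proof (rule poly_eqI_degree_lead_coeff[where n = m and A = "{z. z ^ m = 1}"])
    show "coeff ?P m = coeff (monom 1 m - 1) m"
      using lead deg assms by simp
    show "m \<le> card {z::complex. z ^ m = 1}" using card by simp
    show "degree ?P \<le> m" using deg by simp
    show "degree (monom 1 m - 1 :: complex poly) \<le> m"
      by (intro degree_diff_le) (auto simp: degree_monom_le)
    show "poly ?P z = poly (monom 1 m - 1) z" if "z \<in> {z. z ^ m = 1}" for z
    proof -
      from that obtain j where "j \<in> {1..m}" "z = ?z j" using img by blast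
      then have "poly ?P z = 0" by (auto simp: poly_prod intro!: prod_zero)
      then show ?thesis using that by (simp add: poly_monom)
    qed
  qed
qed

text \<open>The multiples of \<open>d\<close> index the \<open>m\<close>-th roots of unity. The
  conditional form puts all products over one index set, so that they can be compared factor by
  factor.\<close>

lemma prod_multiples_roots_of_unity:
  assumes "m > 0" "d > 0"
  shows "(\<Prod>j\<in>{1..d * m}. if d dvd j then [:- cis (2 * pi * real j / real (d * m)), 1:] else 1)
    = monom 1 m - 1"
proof -
  have "(\<Prod>j\<in>{1..d * m}. if d dvd j then [:- cis (2 * pi * real j / real (d * m)), 1:] else 1)
      = (\<Prod>j\<in>{j \<in> {1..d * m}. d dvd j}. [:- cis (2 * pi * real j / real (d * m)), 1:])"
    by (rule prod.inter_filter[symmetric]) simp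
  also have "{j \<in> {1..d * m}. d dvd j} = (\<lambda>j. d * j) ` {1..m}"
    using assms by (auto elim!: dvdE)
  also have "(\<Prod>j\<in>\<dots>. [:- cis (2 * pi * real j / real (d * m)), 1:])
      = (\<Prod>j\<in>{1..m}. [:- cis (2 * pi * real j / real m), 1:])"
    using assms by (subst prod.reindex) (auto simp: inj_on_def mult.left_commute[of _ "real d"])
  finally show ?thesis using prod_roots_of_unity[OF assms(1)] by simp
qed

text \<open>
  Every \<open>n\<close>-th root of unity is a root of the two sides with the same multiplicity, by
  inclusion-exclusion over the primes dividing its exponent.
\<close>
lemma cyclotomic_times:
  fixes p q r :: nat
  assumes "prime p" "prime q" "prime r" and "p \<noteq> q" "p \<noteq> r" "q \<noteq> r"
  defines "X \<equiv> \<lambda>m. monom 1 m - 1 :: complex poly"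
  shows "cyclotomic (p * q * r) * X (q * r) * X (r * p) * X (p * q) * X 1
    = X (p * q * r) * X p * X q * X r"
proof -
  define n where "n = p * q * r"
  have pos: "p > 0" "q > 0" "r > 0" using assms by (auto simp: prime_gt_0_nat)
  have cop: "coprime p q" "coprime p r" "coprime q r"
    using assms by (auto simp: primes_coprime)
  define f where "f = (\<lambda>j. [:- cis (2 * pi * real j / real n), 1:] :: complex poly)"
  have X: "X m = (\<Prod>j\<in>{1..n}. if d dvd j then f j else 1)" if "n = d * m" for d m
  proof -
    have "n > 0" using pos by (simp add: n_def)
    then have "m > 0" "d > 0" using that by auto
    then show ?thesis
      using prod_multiples_roots_of_unity[of m d] unfolding X_def f_def that by simp
  qed
  have "coprime j x \<longleftrightarrow> \<not> x dvd j" if "prime x" for x j :: nat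
    using that by (metis coprime_commute coprime_def dvd_refl not_prime_unit prime_imp_coprime)
  then have "coprime j n \<longleftrightarrow> \<not> p dvd j \<and> \<not> q dvd j \<and> \<not> r dvd j" for j
    using assms(1-3) by (simp add: n_def coprime_mult_right_iff)
  then have cyc: "cyclotomic n
      = (\<Prod>j\<in>{1..n}. if \<not> p dvd j \<and> \<not> q dvd j \<and> \<not> r dvd j then f j else 1)"
    unfolding cyclotomic_def f_def by (subst prod.inter_filter[symmetric]) simp_all
  have dvd: "x * y dvd j \<longleftrightarrow> x dvd j \<and> y dvd j" if "coprime x y" for x y j :: nat
    using that by (meson divides_mult dvd_mult_left dvd_mult_right)
  have "p * q dvd j \<longleftrightarrow> p dvd j \<and> q dvd j" "r * p dvd j \<longleftrightarrow> r dvd j \<and> p dvd j"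
    "q * r dvd j \<longleftrightarrow> q dvd j \<and> r dvd j" "p * q * r dvd j \<longleftrightarrow> p dvd j \<and> q dvd j \<and> r dvd j" for j
    using cop by (simp_all add: dvd coprime_commute)
  \<comment> \<open>Here \<open>this\<close> splits divisibility by a product of primes into a
    conjunction, the form that the case split below needs.\<close>
  note X' = X[where d = "p * q * r" and m = 1, unfolded this]
    X[where d = "p * q" and m = r, unfolded this] X[where d = "r * p" and m = q, unfolded this]
    X[where d = "q * r" and m = p, unfolded this]
  have X_n: "X n = (\<Prod>j\<in>{1..n}. f j)" using X[of 1 n] by simp
  have X_parts: "X (q * r) = (\<Prod>j\<in>{1..n}. if p dvd j then f j else 1)"
    "X (r * p) = (\<Prod>j\<in>{1..n}. if q dvd j then f j else 1)"
    "X (p * q) = (\<Prod>j\<in>{1..n}. if r dvd j then f j else 1)"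
    "X p = (\<Prod>j\<in>{1..n}. if q dvd j \<and> r dvd j then f j else 1)"
    "X q = (\<Prod>j\<in>{1..n}. if r dvd j \<and> p dvd j then f j else 1)"
    "X r = (\<Prod>j\<in>{1..n}. if p dvd j \<and> q dvd j then f j else 1)"
    "X 1 = (\<Prod>j\<in>{1..n}. if p dvd j \<and> q dvd j \<and> r dvd j then f j else 1)"
    by (rule X X', simp add: n_def mult_ac)+
  \<comment> \<open>Multiplicities for a fixed \<open>j\<close>: if 0, 1, 2 or 3 of the primes
    divide it, both sides count 1, 1, 2 or 4.\<close>
  have "(if \<not> P \<and> \<not> Q \<and> \<not> R then x else 1) * (if P then x else 1) * (if Q then x else 1)
      * (if R then x else 1) * (if P \<and> Q \<and> R then x else 1)
    = x * (if Q \<and> R then x else 1) * (if R \<and> P then x else 1) * (if P \<and> Q then x else 1)"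
    for P Q R and x :: "complex poly"
    by (cases P; cases Q; cases R) simp_all
  then show ?thesis
    unfolding n_def[symmetric] X_n X_parts cyc prod.distrib[symmetric] by (simp only:)
qed

lemma fps_mult_one_minus_X_power:
  fixes h :: "int \<Rightarrow> complex"
  assumes "\<And>k. k < 0 \<Longrightarrow> h k = 0"
  shows "Abs_fps (\<lambda>n. h (int n)) * (1 - fps_X ^ m) = Abs_fps (\<lambda>n. h (int n) - h (int n - int m))"
  by (rule fps_ext)
    (auto simp: right_diff_distrib fps_X_power_mult_right_nth assms of_nat_diff)

section \<open>Digits of an integer and their change under subtraction\<close>

locale coprime_triple =
  fixes p q r :: int
  assumes gt_1: "p > 1" "q > 1" "r > 1"
    and coprimes: "coprime p q" "coprime p r" "coprime q r"
begin

lemma pqr_pos: "p * q * r > 0"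
  using gt_1 by simp

abbreviation rep where "rep \<equiv> representation p q r"

lemma represents_rep: "represents p q r k (rep k)"
  unfolding representation_def
  by (rule theI'[OF represents_ex1]) (use gt_1 coprimes in auto)

lemma rep_eqI: "represents p q r k s \<Longrightarrow> rep k = s"
  unfolding representation_def
  by (rule the1_equality[OF represents_ex1]) (use gt_1 coprimes in auto)

lemma rep_cases:
  obtains f a b c where "rep k = (f, a, b, c)" "represents p q r k (f, a, b, c)"
  using represents_rep[of k] by (metis prod_cases4)

text \<open>A multiple of \<open>p\<close> leaving the first digit is worth the same multiple of
  \<open>p * q * r\<close> and moves into \<open>F\<close>. The digits \<alpha>, \<beta>, \<gamma>
  of \<open>s\<close> may be unreduced, as sums of two inverses require.\<close>

lemma rep_diff:
  assumes "rep k = (f, a, b, c)"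
    and "s + g * p * q * r = \<alpha> * q * r + \<beta> * r * p + \<gamma> * p * q"
  shows "rep (k - s) = (f - g - (a - \<alpha>) div p - (b - \<beta>) div q - (c - \<gamma>) div r,
    (a - \<alpha>) mod p, (b - \<beta>) mod q, (c - \<gamma>) mod r)"
proof (rule rep_eqI)
  have "k + f * p * q * r = a * q * r + b * r * p + c * p * q"
    using represents_rep[of k] assms(1) by (simp add: represents_def)
  then have eq: "k - s + (f - g) * p * q * r = (a - \<alpha>) * q * r + (b - \<beta>) * r * p + (c - \<gamma>) * p * q"
    using assms(2) by (simp add: algebra_simps)
  define a\<^sub>0 a\<^sub>1 where a: "a\<^sub>0 = (a - \<alpha>) mod p" "a\<^sub>1 = (a - \<alpha>) div p"
  define b\<^sub>0 b\<^sub>1 where b: "b\<^sub>0 = (b - \<beta>) mod q" "b\<^sub>1 = (b - \<beta>) div q"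
  define c\<^sub>0 c\<^sub>1 where c: "c\<^sub>0 = (c - \<gamma>) mod r" "c\<^sub>1 = (c - \<gamma>) div r"
  have "a - \<alpha> = a\<^sub>0 + a\<^sub>1 * p" "b - \<beta> = b\<^sub>0 + b\<^sub>1 * q" "c - \<gamma> = c\<^sub>0 + c\<^sub>1 * r"
    by (simp_all add: a b c)
  with eq have "k - s + (f - g - a\<^sub>1 - b\<^sub>1 - c\<^sub>1) * p * q * r = a\<^sub>0 * q * r + b\<^sub>0 * r * p + c\<^sub>0 * p * q"
    by algebra
  then show "represents p q r (k - s) (f - g - (a - \<alpha>) div p - (b - \<beta>) div q - (c - \<gamma>) div r,
    (a - \<alpha>) mod p, (b - \<beta>) mod q, (c - \<gamma>) mod r)"
    using gt_1 by (simp add: represents_def a b c)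
qed

lemma rep_diff_qr:
  assumes "rep k = (f, a, b, c)"
  shows "rep (k - q * r) = (if a = 0 then (f + 1, p - 1, b, c) else (f, a - 1, b, c))"
proof -
  have "a \<in> {0..<p}" "b \<in> {0..<q}" "c \<in> {0..<r}"
    using represents_rep[of k] by (auto simp: assms represents_def)
  then show ?thesis
    using rep_diff[OF assms, of "q * r" 0 1 0 0] gt_1
    by (auto simp: zmod_minus1 div_eq_minus1)
qed

lemma rep_diff_rp:
  assumes "rep k = (f, a, b, c)"
  shows "rep (k - r * p) = (if b = 0 then (f + 1, a, q - 1, c) else (f, a, b - 1, c))"
proof -
  have "a \<in> {0..<p}" "b \<in> {0..<q}" "c \<in> {0..<r}"
    using represents_rep[of k] by (auto simp: assms represents_def)
  then show ?thesis
    using rep_diff[OF assms, of "r * p" 0 0 1 0] gt_1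
    by (auto simp: zmod_minus1 div_eq_minus1)
qed

lemma rep_diff_pq:
  assumes "rep k = (f, a, b, c)"
  shows "rep (k - p * q) = (if c = 0 then (f + 1, a, b, r - 1) else (f, a, b, c - 1))"
proof -
  have "a \<in> {0..<p}" "b \<in> {0..<q}" "c \<in> {0..<r}"
    using represents_rep[of k] by (auto simp: assms represents_def)
  then show ?thesis
    using rep_diff[OF assms, of "p * q" 0 0 0 1] gt_1
    by (auto simp: zmod_minus1 div_eq_minus1)
qed

lemma F_bound:
  assumes "rep k = (f, a, b, c)" "a * q * r + b * r * p + c * p * q < k + m * (p * q * r)"
  shows "f < m"
proof -
  have "k + f * p * q * r = a * q * r + b * r * p + c * p * q"
    using represents_rep[of k] assms(1) by (simp add: represents_def)
  then have "f * (p * q * r) < m * (p * q * r)"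
    using assms(2) by (simp add: algebra_simps)
  then show ?thesis
    using gt_1 by (simp add: mult_less_cancel_right)
qed

text \<open>The digit sum is nonnegative. This makes \<open>H\<close> vanish at negative
  indices.\<close>

lemma F_pos_of_neg:
  assumes "rep k = (f, a, b, c)" "k < 0"
  shows "f > 0"
proof -
  have *: "k + f * p * q * r = a * q * r + b * r * p + c * p * q" "a \<ge> 0" "b \<ge> 0" "c \<ge> 0"
    using represents_rep[of k] assms(1) by (simp_all add: represents_def)
  moreover have "a * q * r + b * r * p + c * p * q \<ge> 0"
    using * gt_1 by simp
  ultimately have "f * (p * q * r) > 0"
    using assms(2) by (simp add: mult.assoc)
  then show ?thesis
    using pqr_pos by (rule zero_less_mult_pos2)
qed

section \<open>Generating functions\<close>

text \<open>
  The number of ways to write \<open>k\<close> as a nonnegative combination of \<open>qr\<close>, \<open>rp\<close>, \<open>pq\<close> is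
  \<open>(2 - F\<^sub>k) choose 2\<close>, so this is the coefficient of \<open>x\<^sup>k\<close> in
  \<open>(1 - x\<^bsup>pqr\<^esup>) / ((1 - x\<^bsup>qr\<^esup>) (1 - x\<^bsup>rp\<^esup>) (1 - x\<^bsup>pq\<^esup>))\<close>.
\<close>
definition H :: "int \<Rightarrow> complex" where
  "H k = of_int (max 0 (1 - F p q r k))"

lemma H_neg: "k < 0 \<Longrightarrow> H k = 0"
  using F_pos_of_neg[of k] by (cases k rule: rep_cases) (simp add: H_def F_def)

text \<open>The product telescopes: the first factor leaves the indices with \<open>a = 0\<close>
  and \<open>f\<close> nonpositive, the second forces also \<open>b = 0\<close> and
  \<open>f = 0\<close>, and the third leaves \<open>k = 0\<close> and, with a minus sign,
  \<open>k = p * q * r\<close>.\<close>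

lemma fps_H:
  "Abs_fps (\<lambda>n. H (int n)) * (1 - fps_X ^ nat (q * r)) * (1 - fps_X ^ nat (r * p))
    * (1 - fps_X ^ nat (p * q)) = 1 - fps_X ^ nat (p * q * r)"
proof -
  define H1 :: "int \<Rightarrow> complex" where
    "H1 = (\<lambda>k. case rep k of (f, a, b, c) \<Rightarrow> of_bool (a = 0 \<and> f \<le> 0))"
  define H2 :: "int \<Rightarrow> complex" where
    "H2 = (\<lambda>k. case rep k of (f, a, b, c) \<Rightarrow> of_bool (a = 0 \<and> b = 0 \<and> f = 0))"
  have H1: "H k - H (k - q * r) = H1 k" for k
    by (cases k rule: rep_cases) (auto simp: H_def H1_def F_def rep_diff_qr of_bool_def)
  have H2: "H1 k - H1 (k - r * p) = H2 k" for k
    by (cases k rule: rep_cases) (auto simp: H1_def H2_def rep_diff_rp of_bool_def)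
  have H3: "H2 k - H2 (k - p * q) = of_bool (k = 0) - of_bool (k = p * q * r)" for k
  proof (cases k rule: rep_cases)
    case (1 f a b c)
    have rng: "a \<ge> 0" "b \<ge> 0" "c \<ge> 0" and eq: "k + f * p * q * r = a * q * r + b * r * p + c * p * q"
      using 1 by (auto simp: represents_def)
    have "k = 0 \<longleftrightarrow> (f, a, b, c) = (0, 0, 0, 0)"
    proof
      assume "k = 0"
      then have "represents p q r k (0, 0, 0, 0)" using gt_1 by (simp add: represents_def)
      then show "(f, a, b, c) = (0, 0, 0, 0)" using 1 rep_eqI by metis
    qed (use eq in auto)
    moreover have "k = p * q * r \<longleftrightarrow> (f, a, b, c) = (-1, 0, 0, 0)"
    proof
      assume "k = p * q * r"
      then have "represents p q r k (-1, 0, 0, 0)" using gt_1 by (simp add: represents_def)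
      then show "(f, a, b, c) = (-1, 0, 0, 0)" using 1 rep_eqI by metis
    qed (use eq in auto)
    ultimately show ?thesis
      using 1 by (auto simp: H2_def rep_diff_pq of_bool_def)
  qed
  have neg: "H1 k = 0" "H2 k = 0" if "k < 0" for k
    using F_pos_of_neg[OF _ that] by (cases k rule: rep_cases; force simp: H1_def H2_def)+
  have pos: "q * r \<ge> 0" "r * p \<ge> 0" "p * q \<ge> 0" "p * q * r > 0" using gt_1 by auto
  have "Abs_fps (\<lambda>n. H (int n)) * (1 - fps_X ^ nat (q * r)) = Abs_fps (\<lambda>n. H1 (int n))"
    using pos by (subst fps_mult_one_minus_X_power) (simp_all add: H_neg H1)
  moreover have "Abs_fps (\<lambda>n. H1 (int n)) * (1 - fps_X ^ nat (r * p)) = Abs_fps (\<lambda>n. H2 (int n))"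
    using pos by (subst fps_mult_one_minus_X_power) (simp_all add: neg H2)
  moreover have "Abs_fps (\<lambda>n. H2 (int n)) * (1 - fps_X ^ nat (p * q))
      = Abs_fps (\<lambda>n. of_bool (int n = 0) - of_bool (int n = p * q * r))"
    using pos by (subst fps_mult_one_minus_X_power) (simp_all add: neg H3)
  moreover have "\<dots> = 1 - fps_X ^ nat (p * q * r)"
    using pos by (intro fps_ext) (auto simp: fps_one_nth)
  ultimately show ?thesis by (simp only:)
qed

text \<open>Rewrite the factor of exponent \<open>p * q * r\<close> in
  \<open>cyclotomic_times\<close> by \<open>fps_H\<close>; the three nonzero factors then common to
  both sides cancel.\<close>

lemma fps_cyclotomic:
  assumes "prime p" "prime q" "prime r"
  shows "fps_of_poly (cyclotomic (nat (p * q * r))) * (1 - fps_X)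
    = Abs_fps (\<lambda>n. H (int n)) * (1 - fps_X ^ nat p) * (1 - fps_X ^ nat q) * (1 - fps_X ^ nat r)"
    (is "?Phi * _ = ?H * _ * _ * _")
proof -
  let ?D = "\<lambda>m. 1 - fps_X ^ m :: complex fps"
  let ?X = "\<lambda>m. monom 1 m - 1 :: complex poly"
  have D: "fps_of_poly (?X m) = - ?D m" for m
    by (simp add: fps_of_poly_simps)
  have "p \<noteq> q" "p \<noteq> r" "q \<noteq> r" using coprimes gt_1 by auto
  moreover have pos: "p > 0" "q > 0" "r > 0" using gt_1 by auto
  ultimately have "cyclotomic (nat (p * q * r)) * ?X (nat (q * r)) * ?X (nat (r * p)) * ?X (nat (p * q)) * ?X 1
    = ?X (nat (p * q * r)) * ?X (nat p) * ?X (nat q) * ?X (nat r)"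
    using cyclotomic_times[of "nat p" "nat q" "nat r"] assms
    by (simp add: nat_mult_distrib eq_nat_nat_iff)
  then have "fps_of_poly (cyclotomic (nat (p * q * r)) * ?X (nat (q * r)) * ?X (nat (r * p)) * ?X (nat (p * q)) * ?X 1)
    = fps_of_poly (?X (nat (p * q * r)) * ?X (nat p) * ?X (nat q) * ?X (nat r))"
    by (rule arg_cong)
  \<comment> \<open>Four factors change sign on each side, so no sign remains.\<close>
  then have "?Phi * ?D (nat (q * r)) * ?D (nat (r * p)) * ?D (nat (p * q)) * ?D 1
    = ?D (nat (p * q * r)) * ?D (nat p) * ?D (nat q) * ?D (nat r)"
    unfolding fps_of_poly_mult D by (simp only: mult_minus_left mult_minus_right minus_minus)
  then have "(?Phi * ?D 1) * (?D (nat (q * r)) * ?D (nat (r * p)) * ?D (nat (p * q)))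
    = (?H * ?D (nat p) * ?D (nat q) * ?D (nat r)) * (?D (nat (q * r)) * ?D (nat (r * p)) * ?D (nat (p * q)))"
    unfolding fps_H[symmetric] by (simp only: mult_ac)
  moreover have "?D m \<noteq> 0" if "m > 0" for m
    using that by (auto simp: fps_eq_iff intro!: exI[of _ 0])
  then have "?D (nat (q * r)) * ?D (nat (r * p)) * ?D (nat (p * q)) \<noteq> 0"
    using pos by simp
  ultimately show ?thesis by (simp only: mult_cancel_right power_one_right) blast
qed

text \<open>Multiplying by \<open>1 - fps_X\<close> turns the coefficients into \<open>V\<close>;
  expanding the three factors on the other side gives the eight shifts.\<close>

lemma V_eq_H:
  assumes "prime p" "prime q" "prime r" "k \<ge> 0"
  shows "V p q r k = H k - H (k - p) - H (k - q) - H (k - r)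
    + H (k - q - r) + H (k - r - p) + H (k - p - q) - H (k - p - q - r)"
proof -
  have pos: "p > 0" "q > 0" "r > 0" using gt_1 by auto
  define H1 where "H1 = (\<lambda>k. H k - H (k - p))"
  define H2 where "H2 = (\<lambda>k. H1 k - H1 (k - q))"
  have neg: "H1 k = 0" "H2 k = 0" if "k < 0" for k
    using that pos by (simp_all add: H1_def H2_def H_neg)
  have "Abs_fps (\<lambda>n. V p q r (int n)) = fps_of_poly (cyclotomic (nat (p * q * r))) * (1 - fps_X)"
    by (rule fps_ext) (auto simp: V_def cyclo_coeff_def right_diff_distrib nat_diff_distrib)
  also have "\<dots> = Abs_fps (\<lambda>n. H (int n)) * (1 - fps_X ^ nat p) * (1 - fps_X ^ nat q) * (1 - fps_X ^ nat r)"
    using assms by (intro fps_cyclotomic)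
  also have "Abs_fps (\<lambda>n. H (int n)) * (1 - fps_X ^ nat p) = Abs_fps (\<lambda>n. H1 (int n))"
    using pos by (subst fps_mult_one_minus_X_power) (simp_all add: H_neg H1_def)
  also have "\<dots> * (1 - fps_X ^ nat q) = Abs_fps (\<lambda>n. H2 (int n))"
    using pos by (subst fps_mult_one_minus_X_power) (simp_all add: neg H2_def)
  also have "\<dots> * (1 - fps_X ^ nat r) = Abs_fps (\<lambda>n. H2 (int n) - H2 (int n - r))"
    using pos by (subst fps_mult_one_minus_X_power) (simp_all add: neg)
  finally have "V p q r (int (nat k)) = H2 (int (nat k)) - H2 (int (nat k) - r)"
    by (simp only: fps_eq_iff fps_nth_Abs_fps)
  then show ?thesis
    using assms(4) by (simp add: H1_def H2_def algebra_simps)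
qed

end

section \<open>Inverses and borrows\<close>

text \<open>The left side is 1 modulo \<open>x\<close> and modulo \<open>y\<close>, and lies
  strictly between \<open>1\<close> and \<open>2 * x * y + 1\<close>.\<close>

lemma modular_inverse_mult_sum:
  fixes x y :: int
  assumes "x > 1" "y > 1" "coprime x y"
  shows "x * modular_inverse y x + y * modular_inverse x y = x * y + 1"
proof -
  define u v where "u = modular_inverse y x" "v = modular_inverse x y"
  have uv: "0 < u" "u < y" "0 < v" "v < x"
    using assms by (auto simp: u_v_def modular_inverse_int_less mult_modular_inverse_int_pos coprime_commute)
  have "[x * u = 1] (mod y)" "[y * v = 1] (mod x)"
    using assms by (auto simp: u_v_def intro!: cong_modular_inverse1 simp: coprime_commute)
  then have "y dvd (x * u - 1) + y * v" "x dvd x * u + (y * v - 1)"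
    by (auto simp: cong_iff_dvd_diff intro: dvd_add)
  then have "x * y dvd x * u + y * v - 1"
    using assms(3) by (intro divides_mult) (simp_all add: algebra_simps)
  then obtain w where w: "x * u + y * v - 1 = x * y * w" by (elim dvdE)
  have "x * u \<ge> x" "y * v \<ge> y" "x * u \<le> x * y - x" "y * v \<le> y * x - y"
    using mult_left_mono[of 1 u x] mult_left_mono[of 1 v y]
      mult_left_mono[of "u + 1" y x] mult_left_mono[of "v + 1" x y] uv assms
    by (simp_all add: distrib_left)
  then have "x * y * 0 < x * y * w" "x * y * w < x * y * 2"
    using assms(1,2) unfolding w[symmetric] by (simp_all only: mult.commute[of y x])
  moreover have "x * y > 0" using assms by simp
  ultimately have "w = 1"
    by (simp only: mult_less_cancel_left_pos)
  then show ?thesis using w by (simp add: u_v_def)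
qed

text \<open>
  Subtracting \<open>s\<close> from the digit \<open>x\<close> modulo \<open>m\<close> increases \<open>F\<close> by the number of times that
  \<open>m\<close> has to be borrowed.
\<close>
definition borrow :: "int \<Rightarrow> int \<Rightarrow> int \<Rightarrow> int" where
  "borrow m x s = - ((x - s) div m)"

text \<open>Since \<open>x - s\<close> is at least \<open>- 2 * m\<close>, at most two borrows
  occur. The range of \<open>s\<close> covers a sum of two inverses.\<close>

lemma borrow_eq:
  assumes "0 \<le> x" "x < m" "0 \<le> s" "s \<le> 2 * m"
  shows "borrow m x s = of_bool (x < s) + of_bool (x < s - m)"
proof -
  have "(x - s) div m = - (of_bool (x < s) + of_bool (x < s - m))"
    using assms by (intro int_div_pos_eq[where r = "x - s + m * (of_bool (x < s) + of_bool (x < s - m))"])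
      (auto simp: algebra_simps)
  then show ?thesis by (simp add: borrow_def)
qed

definition borrows :: "int \<Rightarrow> int \<Rightarrow> int \<Rightarrow> int \<Rightarrow> int \<times> int \<times> int" where
  "borrows x y z d = (let s = modular_inverse x y; t = modular_inverse x z in
    (borrow x d s, borrow x d t, borrow x d (s + t)))"

text \<open>
  The borrows on the \<open>j\<close>-th interval, where \<open>e\<close> tells whether the first of the two inverses
  is the smaller one.
\<close>
fun profile :: "nat \<Rightarrow> int \<Rightarrow> int \<times> int \<times> int" where
  "profile j e = [(1, 1, 2), (1, 1, 1), (1 - e, e, 1), (0, 0, 1), (0, 0, 0)] ! j"

text \<open>The intervals are cut at the thresholds where one of the borrows changes. A digit in the
  middle interval shows that the two inverses differ, so the two values of \<delta> are
  complementary.\<close>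

lemma borrows_eq_profile:
  assumes "d \<in> \<A> x y z j" "j < 5"
  shows "borrows x y z d = profile j (\<delta> y z x)"
    and "j = 2 \<Longrightarrow> \<delta> z y x = 1 - \<delta> y z x"
proof -
  define s t where st: "s = modular_inverse x y" "t = modular_inverse x z"
  have d: "0 \<le> d" "d < x" and reg: "d \<in> [{0..<s + t - x}, {s + t - x..<min s t}, {min s t..<max s t},
      {max s t..<s + t}, {s + t..<x}] ! j"
    using assms(1) by (auto simp: \<A>_def Let_def st)
  then have rng: "0 \<le> s" "s < x" "0 \<le> t" "t < x"
    by (auto simp: st modular_inverse_int_nonneg modular_inverse_int_less)
  have "j \<in> {0, 1, 2, 3, 4}" using assms(2) by auto
  then show "borrows x y z d = profile j (\<delta> y z x)" "j = 2 \<Longrightarrow> \<delta> z y x = 1 - \<delta> y z x"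
    using reg d rng
    by (auto simp: borrows_def Let_def st[symmetric] borrow_eq \<delta>_def min_def max_def split: if_splits)
qed

text \<open>
  The arguments \<open>aq\<close>, \<open>ar\<close>, \<open>aqr\<close> are the borrows that occur when \<open>q\<^sup>-\<^sup>1(p)\<close>, \<open>r\<^sup>-\<^sup>1(p)\<close> and their sum
  are subtracted from \<open>a\<^sub>k\<close>, and similarly for the other digits.
\<close>
fun oct_of :: "int \<Rightarrow> int \<times> int \<times> int \<Rightarrow> int \<times> int \<times> int \<Rightarrow> int \<times> int \<times> int \<Rightarrow> int list" where
  "oct_of f (aq, ar, aqr) (br, bp, brp) (cp, cq, cpq) =
    [f, f - 1 + br + cq, f - 1 + ar + cp, f - 1 + aq + bp,
     f - 2 + aqr + bp + cp, f - 2 + aq + brp + cq, f - 2 + ar + br + cpq,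
     f - 3 + aqr + brp + cpq]"

definition signed_count :: "int list \<Rightarrow> int" where
  "signed_count xs = (let h = (\<lambda>i. max 0 (1 - xs ! i)) in
    h 0 - h 1 - h 2 - h 3 + h 4 + h 5 + h 6 - h 7)"

text \<open>
  The constraints on \<open>F\<^sub>k\<close> that hold for \<open>0 \<le> k < pqr\<close>; they fix the shift of the octant whenever
  \<open>V(k) \<noteq> 0\<close>.
\<close>
fun admissible :: "int \<Rightarrow> int \<times> int \<times> int \<Rightarrow> int \<times> int \<times> int \<Rightarrow> int \<times> int \<times> int \<Rightarrow> bool" where
  "admissible f (aq, ar, aqr) (br, bp, brp) (cp, cq, cpq) \<longleftrightarrow>
    (\<forall>x \<in> set (oct_of f (aq, ar, aqr) (br, bp, brp) (cp, cq, cpq)). 0 \<le> x) \<and>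
    f \<le> 2 \<and>
    (aqr \<ge> 1 \<and> brp \<ge> 1 \<and> cpq \<ge> 1 \<longrightarrow> f \<le> 5 - aqr - brp - cpq) \<and>
    (aq = 1 \<and> bp = 1 \<longrightarrow> f \<le> 1) \<and>
    (br = 1 \<and> cq = 1 \<longrightarrow> f \<le> 1) \<and>
    (aqr = 2 \<and> bp = 1 \<and> cp = 1 \<longrightarrow> f \<le> 0) \<and>
    (ar = 1 \<and> br = 1 \<and> cpq \<ge> 1 \<longrightarrow> f \<le> 1)"

section \<open>Octants and their shifts\<close>

context coprime_triple
begin

text \<open>Negative \<open>k\<close> are included, so the bound applies to all eight shifted
  indices.\<close>

lemma F_nonneg:
  assumes "k < p * q * r"
  shows "F p q r k \<ge> 0"
proof (cases k rule: rep_cases)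
  case (1 f a b c)
  then have "k + f * p * q * r = a * q * r + b * r * p + c * p * q" "a \<ge> 0" "b \<ge> 0" "c \<ge> 0"
    by (simp_all add: represents_def)
  moreover have "a * q * r + b * r * p + c * p * q \<ge> 0"
    using calculation gt_1 by simp
  ultimately have "(f + 1) * (p * q * r) > 0"
    using assms by (simp add: algebra_simps)
  then have "f + 1 > 0" using pqr_pos by (rule zero_less_mult_pos2)
  then show ?thesis using 1 by (simp add: F_def)
qed

lemma oct_eq:
  assumes "abc p q r k = (a, b, c)"
  shows "oct p q r k = oct_of (F p q r k) (borrows p q r a) (borrows q r p b) (borrows r p q c)"
proof -
  define f where "f = F p q r k"
  have rep: "rep k = (f, a, b, c)"
    using assms by (simp add: f_def F_def abc_def prod_eq_iff)
  have diff: "F p q r (k - s) = f - g + borrow p a \<alpha> + borrow q b \<beta> + borrow r c \<gamma>"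
    if "s + g * p * q * r = \<alpha> * q * r + \<beta> * r * p + \<gamma> * p * q" for s g \<alpha> \<beta> \<gamma>
    using rep_diff[OF rep that] by (simp add: F_def borrow_def)
  have "0 \<le> a" "a < p" "0 \<le> b" "b < q" "0 \<le> c" "c < r"
    using represents_rep[of k] by (simp_all add: rep represents_def)
  then have zero: "borrow p a 0 = 0" "borrow q b 0 = 0" "borrow r c 0 = 0"
    by (simp_all add: borrow_def)
  define aq ar br bp cp cq where inv: "aq = modular_inverse p q" "ar = modular_inverse p r"
    "br = modular_inverse q r" "bp = modular_inverse q p" "cp = modular_inverse r p" "cq = modular_inverse r q"
  have "q * aq + p * bp = q * p + 1" "r * ar + p * cp = r * p + 1" "r * br + q * cq = r * q + 1"
    using gt_1 coprimes unfolding inv by (intro modular_inverse_mult_sum; simp add: coprime_commute)+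
  \<comment> \<open>Each identity times the third prime represents that prime with
    \<open>g = 1\<close>; adding these represents the sums, with \<open>g\<close> counting the
    primes.\<close>
  then have "p + 1 * p * q * r = 0 * q * r + br * r * p + cq * p * q"
    "q + 1 * p * q * r = ar * q * r + 0 * r * p + cp * p * q"
    "r + 1 * p * q * r = aq * q * r + bp * r * p + 0 * p * q"
    "q + r + 2 * p * q * r = (aq + ar) * q * r + bp * r * p + cp * p * q"
    "r + p + 2 * p * q * r = aq * q * r + (br + bp) * r * p + cq * p * q"
    "p + q + 2 * p * q * r = ar * q * r + br * r * p + (cp + cq) * p * q"
    "p + q + r + 3 * p * q * r = (aq + ar) * q * r + (br + bp) * r * p + (cp + cq) * p * q"
    by algebra+
  note this[THEN diff]
  then show ?thesis
    unfolding oct_def diff_diff_eq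
    by (simp add: borrows_def Let_def inv[symmetric] zero f_def[symmetric])
qed

lemma V_eq_signed_count:
  assumes "prime p" "prime q" "prime r" "k \<ge> 0"
  shows "V p q r k = of_int (signed_count (oct p q r k))"
  using V_eq_H[OF assms] by (simp add: signed_count_def oct_def H_def Let_def)

text \<open>The lower bounds are \<open>F_nonneg\<close> at the eight indices. For the upper bounds,
  a borrow puts a digit below an inverse or a sum of inverses, and \<open>sums\<close> evaluates the
  resulting bound on the digit sum.\<close>

lemma admissible:
  assumes "0 \<le> k" "k < p * q * r" "abc p q r k = (a, b, c)"
  shows "admissible (F p q r k) (borrows p q r a) (borrows q r p b) (borrows r p q c)"
proof -
  define f where "f = F p q r k"
  define A B C N where ABC: "A = a * (q * r)" "B = b * (r * p)" "C = c * (p * q)" "N = p * q * r"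
  have rep: "rep k = (f, a, b, c)"
    using assms by (simp add: f_def F_def abc_def prod_eq_iff)
  have bound: "f < m" if "A + B + C < m * N" for m
    using F_bound[OF rep, of m] that assms(1) by (simp add: ABC mult.assoc)
  have rng: "0 \<le> a" "a < p" "0 \<le> b" "b < q" "0 \<le> c" "c < r"
    using represents_rep[of k] by (simp_all add: rep represents_def)
  define aq ar br bp cp cq where inv: "aq = modular_inverse p q" "ar = modular_inverse p r"
    "br = modular_inverse q r" "bp = modular_inverse q p" "cp = modular_inverse r p" "cq = modular_inverse r q"
  have inv_rng: "0 \<le> aq" "aq < p" "0 \<le> ar" "ar < p" "0 \<le> br" "br < q" "0 \<le> bp" "bp < q"
    "0 \<le> cp" "cp < r" "0 \<le> cq" "cq < r"
    using gt_1 by (simp_all add: inv modular_inverse_int_nonneg modular_inverse_int_less)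
  have "q * aq + p * bp = q * p + 1" "r * ar + p * cp = r * p + 1" "r * br + q * cq = r * q + 1"
    using gt_1 coprimes unfolding inv by (intro modular_inverse_mult_sum; simp add: coprime_commute)+
  then have sums: "aq * (q * r) + bp * (r * p) = N + r" "ar * (q * r) + cp * (p * q) = N + q"
    "br * (r * p) + cq * (p * q) = N + p"
    unfolding ABC by algebra+
  \<comment> \<open>The excesses \<open>r\<close>, \<open>q\<close>, \<open>p\<close> in
    \<open>sums\<close> are outweighed by the \<open>q * r\<close>, \<open>r * p\<close>,
    \<open>p * q\<close> that strict digit inequalities save.\<close>
  have small: "r < q * r" "p < r * p" "q < p * q" using gt_1 by simp_all
  have A: "A \<le> y * (q * r) - q * r" if "a < y" for y
    using mult_right_mono[of "a + 1" y "q * r"] that gt_1 by (simp add: ABC algebra_simps)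
  have B: "B \<le> y * (r * p) - r * p" if "b < y" for y
    using mult_right_mono[of "b + 1" y "r * p"] that gt_1 by (simp add: ABC algebra_simps)
  have C: "C \<le> y * (p * q) - p * q" if "c < y" for y
    using mult_right_mono[of "c + 1" y "p * q"] that gt_1 by (simp add: ABC algebra_simps)
  have N: "p * (q * r) = N" "q * (r * p) = N" "r * (p * q) = N" by (simp_all add: ABC mult_ac)
  have "\<forall>x \<in> set (oct p q r k). 0 \<le> x"
    using F_nonneg assms(2) gt_1 by (simp add: oct_def)
  then have nonneg: "\<forall>x \<in> set (oct_of f (borrows p q r a) (borrows q r p b) (borrows r p q c)). 0 \<le> x"
    using oct_eq[OF assms(3)] by (simp add: f_def)
  have Ap: "A \<le> N - q * r" and Bq: "B \<le> N - r * p" and Cr: "C \<le> N - p * q"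
    using A[of p] B[of q] C[of r] rng N by simp_all
  have Aq: "A \<le> aq * (q * r) - q * r" if "borrow p a aq = 1"
    using A[of aq] that rng inv_rng by (simp add: borrow_eq)
  have Ar: "A \<le> ar * (q * r) - q * r" if "borrow p a ar = 1"
    using A[of ar] that rng inv_rng by (simp add: borrow_eq)
  have Br: "B \<le> br * (r * p) - r * p" if "borrow q b br = 1"
    using B[of br] that rng inv_rng by (simp add: borrow_eq)
  have Bp: "B \<le> bp * (r * p) - r * p" if "borrow q b bp = 1"
    using B[of bp] that rng inv_rng by (simp add: borrow_eq)
  have Cp: "C \<le> cp * (p * q) - p * q" if "borrow r c cp = 1"
    using C[of cp] that rng inv_rng by (simp add: borrow_eq)
  have Cq: "C \<le> cq * (p * q) - p * q" if "borrow r c cq = 1"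
    using C[of cq] that rng inv_rng by (simp add: borrow_eq)
  \<comment> \<open>A second borrow means \<open>a < aq + ar - p\<close>, which lowers the bound on
    \<open>A\<close> by a further \<open>p * (q * r) = N\<close>.\<close>
  have Aqr: "borrow p a (aq + ar) \<le> 2 \<and>
      A + (borrow p a (aq + ar) - 1) * N \<le> aq * (q * r) + ar * (q * r) - q * r"
    if "borrow p a (aq + ar) \<ge> 1"
    using A[of "aq + ar"] A[of "aq + ar - p"] that rng inv_rng N
    by (auto simp: borrow_eq distrib_right left_diff_distrib)
  have Brp: "borrow q b (br + bp) \<le> 2 \<and>
      B + (borrow q b (br + bp) - 1) * N \<le> br * (r * p) + bp * (r * p) - r * p"
    if "borrow q b (br + bp) \<ge> 1"
    using B[of "br + bp"] B[of "br + bp - q"] that rng inv_rng N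
    by (auto simp: borrow_eq distrib_right left_diff_distrib)
  have Cpq: "borrow r c (cp + cq) \<le> 2 \<and>
      C + (borrow r c (cp + cq) - 1) * N \<le> cp * (p * q) + cq * (p * q) - p * q"
    if "borrow r c (cp + cq) \<ge> 1"
    using C[of "cp + cq"] C[of "cp + cq - r"] that rng inv_rng N
    by (auto simp: borrow_eq distrib_right left_diff_distrib)
  have "f \<le> 2"
    using bound[of 3] Ap Bq Cr small gt_1 by linarith
  \<comment> \<open>The six inverses together contribute \<open>3 * N\<close> and a small excess;
    each borrow beyond three takes off \<open>N\<close>.\<close>
  moreover have "f \<le> 5 - borrow p a (aq + ar) - borrow q b (br + bp) - borrow r c (cp + cq)"
    if "borrow p a (aq + ar) \<ge> 1" "borrow q b (br + bp) \<ge> 1" "borrow r c (cp + cq) \<ge> 1"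
    using bound[of "6 - borrow p a (aq + ar) - borrow q b (br + bp) - borrow r c (cp + cq)"]
      Aqr[OF that(1)] Brp[OF that(2)] Cpq[OF that(3)] sums small
    by (simp add: left_diff_distrib)
  moreover have "f \<le> 1" if "borrow p a aq = 1" "borrow q b bp = 1"
    using bound[of 2] Aq[OF that(1)] Bp[OF that(2)] Cr sums small gt_1 by linarith
  moreover have "f \<le> 1" if "borrow q b br = 1" "borrow r c cq = 1"
    using bound[of 2] Br[OF that(1)] Cq[OF that(2)] Ap sums small gt_1 by linarith
  \<comment> \<open>The inverses in play contribute \<open>2 * N\<close> and a small excess, and the
    second borrow of \<open>a\<close> takes off \<open>N\<close>.\<close>
  moreover have "f \<le> 0" if "borrow p a (aq + ar) = 2" "borrow q b bp = 1" "borrow r c cp = 1"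
  proof -
    have "A + N \<le> aq * (q * r) + ar * (q * r) - q * r" using Aqr that(1) by simp
    then show ?thesis
      using bound[of 1] Bp[OF that(2)] Cp[OF that(3)] sums small gt_1 by linarith
  qed
  moreover have "f \<le> 1" if "borrow p a ar = 1" "borrow q b br = 1" "borrow r c (cp + cq) \<ge> 1"
  proof -
    have "(borrow r c (cp + cq) - 1) * N \<ge> 0" using that(3) pqr_pos by (simp add: ABC)
    then show ?thesis
      using bound[of 2] Ar[OF that(1)] Br[OF that(2)] Cpq[OF that(3)] sums small gt_1 by linarith
  qed
  ultimately show ?thesis
    using nonneg unfolding f_def[symmetric]
    by (simp only: borrows_def Let_def inv[symmetric] admissible.simps) simp
qed

text \<open>This reduces a cell to a finite check over \<open>f\<close> and the values of \<delta>.
  An octant starts with \<open>f\<close>, so \<open>f - hd ts\<close> is the only possible shift,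
  and naming it removes the existential.\<close>

lemma cell_octant:
  assumes primes: "prime p" "prime q" "prime r" and k: "0 \<le> k" "k < p * q * r"
    and j: "j1 < 5" "j2 < 5" "j3 < 5"
    and octant: "\<And>f. f \<in> {0, 1, 2} \<Longrightarrow>
      admissible f (profile j1 (\<delta> q r p)) (profile j2 (\<delta> r p q)) (profile j3 (\<delta> p q r)) \<Longrightarrow>
      (j1 = 2 \<longrightarrow> \<delta> r q p = 1 - \<delta> q r p \<and> \<delta> q r p \<in> {0, 1}) \<Longrightarrow>
      (j2 = 2 \<longrightarrow> \<delta> p r q = 1 - \<delta> r p q \<and> \<delta> r p q \<in> {0, 1}) \<Longrightarrow>
      (j3 = 2 \<longrightarrow> \<delta> q p r = 1 - \<delta> p q r \<and> \<delta> p q r \<in> {0, 1}) \<Longrightarrow>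
      (let xs = oct_of f (profile j1 (\<delta> q r p)) (profile j2 (\<delta> r p q)) (profile j3 (\<delta> p q r))
       in xs = map (\<lambda>t. t + (f - hd ts)) ts \<and> of_int (signed_count xs) = v)"
  shows "abc p q r k \<in> cell p q r j1 j2 j3 \<longrightarrow> oct p q r k \<sim> ts \<and> V p q r k = v"
proof
  assume cell: "abc p q r k \<in> cell p q r j1 j2 j3"
  obtain a b c where abc: "abc p q r k = (a, b, c)" by (cases "abc p q r k")
  then have *: "a \<in> \<A> p q r j1" "b \<in> \<A> q r p j2" "c \<in> \<A> r p q j3"
    using cell by (simp_all add: cell_def)
  note profiles = borrows_eq_profile(1)[OF *(1) j(1)] borrows_eq_profile(1)[OF *(2) j(2)]
    borrows_eq_profile(1)[OF *(3) j(3)]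
  note \<delta> = borrows_eq_profile(2)[OF *(1) j(1)] borrows_eq_profile(2)[OF *(2) j(2)]
    borrows_eq_profile(2)[OF *(3) j(3)]
  have adm: "admissible (F p q r k) (borrows p q r a) (borrows q r p b) (borrows r p q c)"
    using k abc by (rule admissible)
  then have "F p q r k \<le> 2"
    by (cases "borrows p q r a"; cases "borrows q r p b"; cases "borrows r p q c")
      (simp only: admissible.simps)
  with F_nonneg[OF k(2)] have "F p q r k \<in> {0, 1, 2}" by auto
  then have "let xs = oct p q r k in xs = map (\<lambda>t. t + (F p q r k - hd ts)) ts \<and> of_int (signed_count xs) = v"
    unfolding oct_eq[OF abc] profiles
    using adm \<delta> by (intro octant) (simp_all only: profiles, simp_all add: \<delta>_def)
  then show "oct p q r k \<sim> ts \<and> V p q r k = v"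
    using V_eq_signed_count[OF primes k(1)] by (auto simp: Let_def oct_sim_def)
qed

end

text \<open>Three octants differ from the opening list, as \<open>oct_of\<close> dictates: in cell
  (001) the fifth and seventh entries are 2 and 1, and in (023) and (024) the fourth and fifth
  entries carry \<open>\<delta>rp\<close>, the borrow \<open>bp\<close> there.\<close>

theorem theorem3p1:
  fixes p q r k :: int
  assumes "prime p" "prime q" "prime r"
    and "odd p" "odd q" "odd r"
    and "p \<noteq> q" "p \<noteq> r" "q \<noteq> r"
    and "0 \<le> k" "k \<le> p * q * r - 1"
  shows
    "let \<delta>pq = \<delta> p q r; \<delta>qp = \<delta> q p r;
         \<delta>pr = \<delta> p r q; \<delta>rp = \<delta> r p q;
         \<delta>qr = \<delta> q r p; \<delta>rq = \<delta> r q p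
     in
      (abc p q r k \<in> cell p q r 0 0 1 \<longrightarrow>
        oct p q r k \<sim> [0, 1, 1, 1, 2, 2, 1, 2] \<and>
        V p q r k = 1) \<and>
      (abc p q r k \<in> cell p q r 0 0 2 \<longrightarrow>
        oct p q r k \<sim> [0, \<delta>pq, \<delta>qp, 1, 1 + \<delta>qp, 1 + \<delta>pq, 1, 2] \<and>
        V p q r k = 0) \<and>
      (abc p q r k \<in> cell p q r 0 0 3 \<longrightarrow>
        oct p q r k \<sim> [0, 0, 0, 1, 1, 1, 1, 2] \<and>
        V p q r k = -1) \<and>
      (abc p q r k \<in> cell p q r 0 0 4 \<longrightarrow>
        oct p q r k \<sim> [0, 0, 0, 1, 1, 1, 0, 1] \<and>
        V p q r k = 0) \<and>
      (abc p q r k \<in> cell p q r 0 1 1 \<longrightarrow>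
        oct p q r k \<sim> [0, 1, 1, 1, 2, 1, 1, 1] \<and>
        V p q r k = 1) \<and>
      (abc p q r k \<in> cell p q r 0 1 2 \<longrightarrow>
        oct p q r k \<sim> [0, \<delta>pq, \<delta>qp, 1, 1 + \<delta>qp, \<delta>pq, 1, 1] \<and>
        V p q r k = of_int \<delta>qp) \<and>
      (abc p q r k \<in> cell p q r 0 1 3 \<longrightarrow>
        oct p q r k \<sim> [0, 0, 0, 1, 1, 0, 1, 1] \<and>
        V p q r k = 0) \<and>
      (abc p q r k \<in> cell p q r 0 1 4 \<longrightarrow>
        oct p q r k \<sim> [0, 0, 0, 1, 1, 0, 0, 0] \<and>
        V p q r k = 0) \<and>
      (abc p q r k \<in> cell p q r 0 2 2 \<longrightarrow>
        oct p q r k \<sim> [0, \<delta>pq + \<delta>pr - 1, \<delta>qp, \<delta>rp, \<delta>qp + \<delta>rp, \<delta>pq, \<delta>pr, 1] \<and>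
        V p q r k = 0) \<and>
      (abc p q r k \<in> cell p q r 0 2 3 \<longrightarrow>
        oct p q r k \<sim> [1, \<delta>pr, 1, 1 + \<delta>rp, 1 + \<delta>rp, 1, 1 + \<delta>pr, 2] \<and>
        V p q r k = of_int (-\<delta>rp)) \<and>
      (abc p q r k \<in> cell p q r 0 2 4 \<longrightarrow>
        oct p q r k \<sim> [1, \<delta>pr, 1, 1 + \<delta>rp, 1 + \<delta>rp, 1, \<delta>pr, 1] \<and>
        V p q r k = 0) \<and>
      (abc p q r k \<in> cell p q r 0 3 3 \<longrightarrow>
        oct p q r k \<sim> [1, 0, 1, 1, 1, 1, 1, 2] \<and>
        V p q r k = -1) \<and>
      (abc p q r k \<in> cell p q r 0 3 4 \<longrightarrow>
        oct p q r k \<sim> [1, 0, 1, 1, 1, 1, 0, 1] \<and>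
        V p q r k = 0) \<and>
      (abc p q r k \<in> cell p q r 0 4 4 \<longrightarrow>
        oct p q r k \<sim> [1, 0, 1, 1, 1, 0, 0, 0] \<and>
        V p q r k = 0) \<and>
      (abc p q r k \<in> cell p q r 1 1 1 \<longrightarrow>
        oct p q r k \<sim> [0, 1, 1, 1, 1, 1, 1, 0] \<and>
        V p q r k = 0) \<and>
      (abc p q r k \<in> cell p q r 1 1 2 \<longrightarrow>
        oct p q r k \<sim> [0, \<delta>pq, \<delta>qp, 1, \<delta>qp, \<delta>pq, 1, 0] \<and>
        V p q r k = 0) \<and>
      (abc p q r k \<in> cell p q r 1 1 3 \<longrightarrow>
        oct p q r k \<sim> [0, 0, 0, 1, 0, 0, 1, 0] \<and>
        V p q r k = 0) \<and>
      (abc p q r k \<in> cell p q r 1 1 4 \<longrightarrow>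
        oct p q r k \<sim> [1, 1, 1, 2, 1, 1, 1, 0] \<and>
        V p q r k = -1) \<and>
      (abc p q r k \<in> cell p q r 1 2 2 \<longrightarrow>
        oct p q r k \<sim> [1, \<delta>pq + \<delta>pr, 1 + \<delta>qp, 1 + \<delta>rp, \<delta>qp + \<delta>rp, 1 + \<delta>pq, 1 + \<delta>pr, 1] \<and>
        V p q r k = of_int (\<delta>pq * \<delta>pr - \<delta>qp * \<delta>rp)) \<and>
      (abc p q r k \<in> cell p q r 1 2 3 \<longrightarrow>
        oct p q r k \<sim> [1, \<delta>pr, 1, 1 + \<delta>rp, \<delta>rp, 1, 1 + \<delta>pr, 1] \<and>
        V p q r k = of_int (\<delta>pr - \<delta>rp)) \<and>
      (abc p q r k \<in> cell p q r 1 2 4 \<longrightarrow>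
        oct p q r k \<sim> [1, \<delta>pr, 1, 1 + \<delta>rp, \<delta>rp, 1, \<delta>pr, 0] \<and>
        V p q r k = of_int (-\<delta>rp)) \<and>
      (abc p q r k \<in> cell p q r 1 3 3 \<longrightarrow>
        oct p q r k \<sim> [1, 0, 1, 1, 0, 1, 1, 1] \<and>
        V p q r k = 0) \<and>
      (abc p q r k \<in> cell p q r 1 3 4 \<longrightarrow>
        oct p q r k \<sim> [1, 0, 1, 1, 0, 1, 0, 0] \<and>
        V p q r k = 0) \<and>
      (abc p q r k \<in> cell p q r 1 4 4 \<longrightarrow>
        oct p q r k \<sim> [2, 1, 2, 2, 1, 1, 1, 0] \<and>
        V p q r k = -1) \<and>
      (abc p q r k \<in> cell p q r 2 2 2 \<longrightarrow>
        oct p q r k \<sim> [1, \<delta>pq + \<delta>pr, \<delta>qr + \<delta>qp, \<delta>rp + \<delta>rq, \<delta>qp + \<delta>rp, \<delta>rq + \<delta>pq, \<delta>pr + \<delta>qr, 1] \<and>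
        V p q r k = 0) \<and>
      (abc p q r k \<in> cell p q r 2 2 3 \<longrightarrow>
        oct p q r k \<sim> [1, \<delta>pr, \<delta>qr, \<delta>rp + \<delta>rq, \<delta>rp, \<delta>rq, \<delta>pr + \<delta>qr, 1] \<and>
        V p q r k = of_int (\<delta>pr * \<delta>qr - \<delta>rp * \<delta>rq)) \<and>
      (abc p q r k \<in> cell p q r 2 2 4 \<longrightarrow>
        oct p q r k \<sim> [1, \<delta>pr, \<delta>qr, \<delta>rp + \<delta>rq, \<delta>rp, \<delta>rq, \<delta>pr + \<delta>qr - 1, 0] \<and>
        V p q r k = 0) \<and>
      (abc p q r k \<in> cell p q r 2 3 3 \<longrightarrow>
        oct p q r k \<sim> [1, 0, \<delta>qr, \<delta>rq, 0, \<delta>rq, \<delta>qr, 1] \<and>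
        V p q r k = 0) \<and>
      (abc p q r k \<in> cell p q r 2 3 4 \<longrightarrow>
        oct p q r k \<sim> [2, 1, 1 + \<delta>qr, 1 + \<delta>rq, 1, 1 + \<delta>rq, \<delta>qr, 1] \<and>
        V p q r k = of_int \<delta>rq) \<and>
      (abc p q r k \<in> cell p q r 2 4 4 \<longrightarrow>
        oct p q r k \<sim> [2, 1, 1 + \<delta>qr, 1 + \<delta>rq, 1, \<delta>rq, \<delta>qr, 0] \<and>
        V p q r k = 0) \<and>
      (abc p q r k \<in> cell p q r 3 3 3 \<longrightarrow>
        oct p q r k \<sim> [1, 0, 0, 0, 0, 0, 0, 1] \<and>
        V p q r k = 0) \<and>
      (abc p q r k \<in> cell p q r 3 3 4 \<longrightarrow>
        oct p q r k \<sim> [2, 1, 1, 1, 1, 1, 0, 1] \<and>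
        V p q r k = 1) \<and>
      (abc p q r k \<in> cell p q r 3 4 4 \<longrightarrow>
        oct p q r k \<sim> [2, 1, 1, 1, 1, 0, 0, 0] \<and>
        V p q r k = 1)"
proof -
  interpret coprime_triple p q r
    using assms by unfold_locales (auto simp: primes_coprime dest: prime_gt_1_int)
  have k: "0 \<le> k" "k < p * q * r" using assms by simp_all
  show ?thesis
    unfolding Let_def
    by (intro conjI cell_octant[OF assms(1-3) k]) (auto simp: Let_def signed_count_def)
qed

end
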